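(* Let $m=\frac12(\delta_1+\delta_{-1})$ on $\mathbb{R}$. Then $$\|f_r\|_{1/r^2,m}\le\|f\|_{1,m}$$ for every $r\in(0,1]$ and every log-convex function $f$ on $\mathbb{R}$, where $f_r(x)=f(rx)$.
   Context: A function $f:\mathbb{R}\to(0,\infty)$ is log-convex if $\log f$ is convex. For $0<p<\infty$, $\|f\|_{p,m}=(\int|f|^p\,dm)^{1/p}$. $\delta_x$ denotes the Dirac mass at $x$. *)

theory Defs
  imports "HOL-Probability.Probability"
begin

definition log_convex :: "(real \<Rightarrow> real) \<Rightarrow> bool" where
  "log_convex f \<longleftrightarrow> (\<forall>x. f x > 0) \<and> convex_on UNIV (\<lambda>x. ln (f x))"

text \<open>Pointwise sum of two measures on the same measurable space. The library's
  \<open>sup\<close> on measures agrees with it only for mutually singular measures.\<close>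

definition add_measure :: "'a measure \<Rightarrow> 'a measure \<Rightarrow> 'a measure" where
  "add_measure M N = measure_of (space M) (sets M) (\<lambda>A. emeasure M A + emeasure N A)"

text \<open>The measure \<open>measure_of\<close> is the zero measure unless its argument is countably
  additive; the following facts show that this default does not arise here.\<close>

lemma space_add_measure [simp]: "space (add_measure M N) = space M"
  and sets_add_measure [measurable_cong, simp]: "sets (add_measure M N) = sets M"
  by (simp_all add: add_measure_def)

lemma emeasure_add_measure:
  assumes "sets N = sets M" "A \<in> sets M"
  shows "emeasure (add_measure M N) A = emeasure M A + emeasure N A"
  unfolding add_measure_def
proof (rule emeasure_measure_of_sigma)
  show "sigma_algebra (space M) (sets M)" ..
  show "positive (sets M) (\<lambda>A. emeasure M A + emeasure N A)"
    by (simp add: positive_def)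
  show "countably_additive (sets M) (\<lambda>A. emeasure M A + emeasure N A)"
    unfolding countably_additive_def
    by (auto simp: suminf_add[symmetric] suminf_emeasure assms(1))
qed fact

definition two_point_measure :: "real measure" where
  "two_point_measure =
     scale_measure (1/2) (add_measure (return borel 1) (return borel (-1)))"

lemma emeasure_two_point_measure:
  assumes "A \<in> sets borel"
  shows "emeasure two_point_measure A = 1/2 * (indicator A 1 + indicator A (-1))"
  using assms by (simp add: two_point_measure_def emeasure_add_measure)

text \<open>For \<open>0 < p < \<infinity>\<close>. The Bochner integral is \<open>0\<close> for non-integrable integrands, so
  this is the usual quantity when \<open>\<bar>f\<bar> powr p\<close> is integrable. A log-convex function is
  continuous, hence Borel measurable, so this always holds for \<open>two_point_measure\<close>.\<close>

definition p_norm :: "real \<Rightarrow> 'a measure \<Rightarrow> ('a \<Rightarrow> real) \<Rightarrow> real" where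
  "p_norm p M f = (\<integral>x. \<bar>f x\<bar> powr p \<partial>M) powr (1 / p)"

end

theory Submission
  imports Defs
begin

text \<open>Put \<open>c = (ln f(1) + ln f(-1))/2\<close> and \<open>d = (ln f(1) - ln f(-1))/2\<close>. Log-convexity gives
  \<open>f(\<plusminus>r) \<le> exp (c \<plusminus> r d)\<close>, with equality at \<open>r = 1\<close>, so the claim reduces to
  \<open>cosh (d/r) powr r\<^sup>2 \<le> cosh d\<close>. This holds because \<open>tanh\<close> is concave on the positive
  half-line: with \<open>d = r x\<close>, the \<open>x\<close>-derivative of \<open>ln (cosh (r x)) - r\<^sup>2 ln (cosh x)\<close> is
  \<open>r (tanh (r x) - r tanh x)\<close>.\<close>

text \<open>The difference of the two sides vanishes at 0. As \<open>tanh\<close> has derivative 1 -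
  tanh^2, the derivative of this difference is r (tanh^2 y - tanh^2 (r y)), which is nonnegative
  because \<open>tanh\<close> is nonnegative and increasing on the positive half-line.\<close>

lemma tanh_scale_le:
  fixes r x :: real
  assumes "0 \<le> r" "r \<le> 1" "0 \<le> x"
  shows "r * tanh x \<le> tanh (r * x)"
proof -
  have "tanh (r * 0) - r * tanh 0 \<le> tanh (r * x) - r * tanh x"
  proof (rule DERIV_nonneg_imp_nondecreasing[OF assms(3)])
    fix y :: real assume y: "0 \<le> y" "y \<le> x"
    have "((\<lambda>y. tanh (r * y) - r * tanh y) has_real_derivative
            r * (tanh y ^ 2 - tanh (r * y) ^ 2)) (at y)"
      by (auto intro!: derivative_eq_intros simp: algebra_simps)
    moreover have "tanh (r * y) \<le> tanh y"
      using assms y by (simp add: mult_left_le_one_le)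
    then have "0 \<le> r * (tanh y ^ 2 - tanh (r * y) ^ 2)"
      using assms y by (intro mult_nonneg_nonneg) (auto intro!: power_mono)
    ultimately show "\<exists>D. ((\<lambda>y. tanh (r * y) - r * tanh y) has_real_derivative D) (at y) \<and> 0 \<le> D"
      by blast
  qed
  then show ?thesis by simp
qed

lemma ln_cosh_scale_le:
  fixes r x :: real
  assumes "0 \<le> r" "r \<le> 1"
  shows "r\<^sup>2 * ln (cosh x) \<le> ln (cosh (r * x))"
proof -
  \<comment> \<open>Both sides are even in x, so the monotonicity argument from 0 is only run for
    nonnegative x. Negative x does occur later, since \<open>d\<close> can have either sign.\<close>
  have *: "r\<^sup>2 * ln (cosh x) \<le> ln (cosh (r * x))" if "0 \<le> x" for x :: real
  proof -
    have "ln (cosh (r * 0)) - r\<^sup>2 * ln (cosh 0) \<le> ln (cosh (r * x)) - r\<^sup>2 * ln (cosh x)"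
    proof (rule DERIV_nonneg_imp_nondecreasing[OF that])
      fix y :: real assume y: "0 \<le> y" "y \<le> x"
      have "((\<lambda>y. ln (cosh (r * y)) - r\<^sup>2 * ln (cosh y)) has_real_derivative
              r * (tanh (r * y) - r * tanh y)) (at y)"
        by (auto intro!: derivative_eq_intros
              simp: tanh_def field_simps power2_eq_square cosh_real_pos)
      moreover have "0 \<le> r * (tanh (r * y) - r * tanh y)"
        using tanh_scale_le[of r y] assms y by simp
      ultimately show "\<exists>D. ((\<lambda>y. ln (cosh (r * y)) - r\<^sup>2 * ln (cosh y))
          has_real_derivative D) (at y) \<and> 0 \<le> D"
        by blast
    qed
    then show ?thesis by simp
  qed
  show ?thesis
    using *[of x] *[of "-x"] by (cases "0 \<le> x") auto
qed

text \<open>A finite convex function on the whole line is continuous, and f is the exponential of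
  one. This supplies the measurability of f needed to evaluate the integrals.\<close>

lemma log_convex_continuous:
  assumes "log_convex f"
  shows "continuous_on UNIV f"
proof -
  have "continuous_on UNIV (\<lambda>x. exp (ln (f x)))"
    using assms convex_on_continuous[of UNIV "\<lambda>x. ln (f x)"]
    by (intro continuous_on_exp) (auto simp: log_convex_def)
  then show ?thesis using assms by (simp add: log_convex_def)
qed

text \<open>The affine function c + r d is the chord of ln f over [-1, 1], and a convex function
  lies below its chord.\<close>

lemma log_convex_le_exp:
  assumes f: "log_convex f" and r: "\<bar>r\<bar> \<le> 1"
  defines "c \<equiv> (ln (f 1) + ln (f (-1))) / 2" and "d \<equiv> (ln (f 1) - ln (f (-1))) / 2"
  shows "f r \<le> exp (c + r * d)"
proof -
  have cv: "convex_on UNIV (\<lambda>x. ln (f x))" using f by (simp add: log_convex_def)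
  \<comment> \<open>The point r is the convex combination of 1 and -1 with weight (1 - r)/2 on
    -1.\<close>
  have "ln (f ((1 - (1 - r) / 2) *\<^sub>R 1 + ((1 - r) / 2) *\<^sub>R (-1)))
      \<le> (1 - (1 - r) / 2) * ln (f 1) + ((1 - r) / 2) * ln (f (-1))"
    using r by (intro convex_onD[OF cv]) auto
  also have "(1 - (1 - r) / 2) *\<^sub>R 1 + ((1 - r) / 2) *\<^sub>R (-1) = r"
    by (simp add: field_simps)
  also have "(1 - (1 - r) / 2) * ln (f 1) + ((1 - r) / 2) * ln (f (-1)) = c + r * d"
    by (simp add: c_def d_def field_simps)
  finally show ?thesis
    using f by (metis exp_le_cancel_iff exp_ln log_convex_def)
qed

text \<open>As a uniform distribution on two points, the measure has integrals that are finite
  averages. The identity map in \<open>distr\<close> only passes from the discrete sigma-algebra of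
  the pmf to the Borel one.\<close>

lemma two_point_measure_eq_distr:
  "two_point_measure = distr (measure_pmf (pmf_of_set {1, -1})) borel (\<lambda>x. x)"
proof (rule measure_eqI)
  show "sets two_point_measure = sets (distr (measure_pmf (pmf_of_set {1, -1})) borel (\<lambda>x. x))"
    by (simp add: two_point_measure_def)
  fix A assume "A \<in> sets two_point_measure"
  then have A: "A \<in> sets borel" by (simp add: two_point_measure_def)
  have "emeasure (measure_pmf (pmf_of_set {1, -1 :: real})) A
      = 1/2 * (indicator A 1 + indicator A (-1))"
    by (subst emeasure_pmf_of_set)
       (auto simp: indicator_def Int_insert_left divide_ennreal[symmetric] divide_ennreal_def
          mult.commute)
  then show "emeasure two_point_measure A =
      emeasure (distr (measure_pmf (pmf_of_set {1, -1})) borel (\<lambda>x. x)) A"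
    using A by (simp add: emeasure_two_point_measure emeasure_distr)
qed

lemma integral_two_point_measure:
  fixes g :: "real \<Rightarrow> real"
  assumes "g \<in> borel_measurable borel"
  shows "(\<integral>x. g x \<partial>two_point_measure) = (g 1 + g (-1)) / 2"
  using assms by (simp add: two_point_measure_eq_distr integral_distr integral_pmf_of_set)

theorem proposition4p6:
  fixes f :: "real \<Rightarrow> real" and r :: real
  assumes "log_convex f"
    and "r \<in> {0<..1}"
  shows "p_norm (1 / r\<^sup>2) two_point_measure (\<lambda>x. f (r * x)) \<le> p_norm 1 two_point_measure f"
proof -
  have r: "0 < r" "r \<le> 1" using assms(2) by auto
  have pos: "f x > 0" for x using assms(1) by (simp add: log_convex_def)
  have [measurable]: "f \<in> borel_measurable borel"
    by (rule borel_measurable_continuous_onI[OF log_convex_continuous[OF assms(1)]])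
  define c where "c = (ln (f 1) + ln (f (-1))) / 2"
  define d where "d = (ln (f 1) - ln (f (-1))) / 2"
  \<comment> \<open>The exponent s d / r^2 is split for use at s = r and s = -r: there s / r is 1 or
    -1, so the two bounds average to a multiple of cosh (d / r).\<close>
  have le: "f s powr (1 / r\<^sup>2) \<le> exp (c / r\<^sup>2) * exp (s / r * (d / r))" if "\<bar>s\<bar> \<le> 1" for s
  proof -
    have "f s powr (1 / r\<^sup>2) \<le> exp (c + s * d) powr (1 / r\<^sup>2)"
      using log_convex_le_exp[OF assms(1) that] pos[of s]
      by (intro powr_mono2) (auto simp: c_def d_def)
    also have "\<dots> = exp (c / r\<^sup>2) * exp (s / r * (d / r))"
      using r by (simp add: powr_def power2_eq_square add_divide_distrib flip: exp_add)
    finally show ?thesis .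
  qed
  have "p_norm (1 / r\<^sup>2) two_point_measure (\<lambda>x. f (r * x))
      = ((f r powr (1 / r\<^sup>2) + f (- r) powr (1 / r\<^sup>2)) / 2) powr r\<^sup>2"
    using pos by (simp add: p_norm_def integral_two_point_measure abs_of_pos)
  also have "\<dots> \<le> (exp (c / r\<^sup>2) * cosh (d / r)) powr r\<^sup>2"
    using le[of r] le[of "-r"] r
    by (intro powr_mono2) (auto simp: cosh_def algebra_simps)
  also have "\<dots> = exp (c + r\<^sup>2 * ln (cosh (d / r)))"
    using r by (simp add: powr_def ln_mult cosh_real_pos algebra_simps)
  also have "\<dots> \<le> exp (c + ln (cosh d))"
    using ln_cosh_scale_le[of r "d / r"] r by simp
  also have "\<dots> = exp c * cosh d"
    by (simp add: exp_add cosh_real_pos)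
  also have "\<dots> = (exp (c + d) + exp (c - d)) / 2"
    by (simp add: cosh_def exp_add exp_diff exp_minus field_simps)
  \<comment> \<open>By the choice of \<open>c\<close> and \<open>d\<close>, c + d = ln f(1) and c -
    d = ln f(-1).\<close>
  also have "\<dots> = (f 1 + f (-1)) / 2"
    using pos[of 1] pos[of "-1"] by (simp add: c_def d_def field_simps)
  also have "\<dots> = p_norm 1 two_point_measure f"
    using pos[of 1] pos[of "-1"] by (simp add: p_norm_def integral_two_point_measure)
  finally show ?thesis .
qed

end
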